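(* Let $(M,P,g)$ be a Riemannian almost product $\mathcal{W}_3$-manifold which does not belong to the class $\mathcal{W}_0$ (i.e. the tensor $F$ is not identically zero). Let $\nabla'$ be a natural connection on $(M,P,g)$ with torsion $(0,3)$-tensor $T$, and let $p_1$ and $p_3$ be the components of $T$ given by \[ \begin{aligned} p_1(x,y,z)=\tfrac18\bigl\{&2T(x,y,z)-T(y,z,x)-T(z,x,y)-T(Pz,x,Py)+T(Py,z,Px)\\ &+T(z,Px,Py)-2T(Px,Py,z)+T(Py,Pz,x)+T(Pz,Px,y)-T(y,Pz,Px)\bigr\},\\ p_3(x,y,z)=\tfrac14\bigl\{&T(x,y,z)+T(Px,Py,z)-T(Px,y,Pz)-T(x,Py,Pz)\bigr\}. \end{aligned} \] Then $p_1=0$ and $p_3\neq 0$ (i.e. $p_3$ is not identically zero).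
   Context: A Riemannian almost product manifold $(M,P,g)$ is a differentiable manifold $M$ with a $(1,1)$-tensor field $P$ and a Riemannian metric $g$ such that $P^2x=x$ and $g(Px,Py)=g(x,y)$ for all vector fields $x,y$; throughout it is assumed that $\mathrm{tr}\,P=0$. Let $\nabla$ be the Levi-Civita connection of $g$ and $F(x,y,z)=g((\nabla_xP)y,z)$. The class $\mathcal{W}_0$ (Riemannian $P$-manifolds) is defined by $F=0$. The class $\mathcal{W}_3$ is defined by $F(x,y,z)+F(y,z,x)+F(z,x,y)=0$ for all $x,y,z$; its members are called Riemannian almost product $\mathcal{W}_3$-manifolds. A natural connection is a linear connection $\nabla'$ with $\nabla'P=0$ and $\nabla'g=0$. Its torsion is $T(x,y)=\nabla'_xy-\nabla'_yx-[x,y]$, and the corresponding $(0,3)$-tensor is $T(x,y,z)=g(T(x,y),z)$. *)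

theory Defs
  imports "HOL-Analysis.Analysis" "HOL-Library.Function_Algebras"
begin

(* Sums, differences and zero of tangent vectors and of vector fields below are the pointwise
   operations on functions provided by Function_Algebras. *)

section \<open>Smooth manifolds\<close>

(* Meaningful only for open S: f is of class C^k on S iff all iterated directional derivatives
   up to order k exist (as values of Frechet derivatives) and are continuous. *)
primrec Ck_on :: "nat \<Rightarrow> 'b::euclidean_space set \<Rightarrow> ('b \<Rightarrow> 'c::real_normed_vector) \<Rightarrow> bool" where
  "Ck_on 0 S f \<longleftrightarrow> continuous_on S f"
| "Ck_on (Suc k) S f \<longleftrightarrow>
     (\<forall>x\<in>S. f differentiable (at x)) \<and>
     (\<forall>v. Ck_on k S (\<lambda>x. frechet_derivative f (at x) v))"

definition smooth_on :: "'b::euclidean_space set \<Rightarrow> ('b \<Rightarrow> 'c::real_normed_vector) \<Rightarrow> bool" where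
  "smooth_on S f \<longleftrightarrow> (\<forall>k. Ck_on k S f)"

type_synonym ('a, 'n) chart = "'a set \<times> ('a \<Rightarrow> real ^ 'n)"

definition is_chart :: "('a::topological_space, 'n::finite) chart \<Rightarrow> bool" where
  "is_chart = (\<lambda>(U, \<phi>). open U \<and> open (\<phi> ` U) \<and> homeomorphism U (\<phi> ` U) \<phi> (inv_into U \<phi>))"

definition smooth_transition ::
    "('a::topological_space, 'n::finite) chart \<Rightarrow> ('a, 'n) chart \<Rightarrow> bool" where
  "smooth_transition = (\<lambda>(U, \<phi>) (V, \<psi>). smooth_on (\<phi> ` (U \<inter> V)) (\<psi> \<circ> inv_into U \<phi>))"

(* The manifold is the whole type 'a, of dimension CARD('n), Hausdorff and second countable by
   the type class constraints; the atlas need not be maximal. *)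
definition smooth_manifold ::
    "('a::{t2_space, second_countable_topology}, 'n::finite) chart set \<Rightarrow> bool" where
  "smooth_manifold \<A> \<longleftrightarrow>
     (\<forall>c\<in>\<A>. is_chart c) \<and> (\<Union>c\<in>\<A>. fst c) = UNIV \<and>
     (\<forall>c\<in>\<A>. \<forall>d\<in>\<A>. smooth_transition c d)"

definition smooth_fun :: "('a::topological_space, 'n::finite) chart set \<Rightarrow> ('a \<Rightarrow> real) \<Rightarrow> bool" where
  "smooth_fun \<A> f \<longleftrightarrow> (\<forall>(U, \<phi>)\<in>\<A>. smooth_on (\<phi> ` U) (f \<circ> inv_into U \<phi>))"

section \<open>Tangent vectors and vector fields\<close>

type_synonym 'a tvec = "('a \<Rightarrow> real) \<Rightarrow> real"
type_synonym 'a vfield = "'a \<Rightarrow> 'a tvec"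

definition tscale :: "real \<Rightarrow> 'a tvec \<Rightarrow> 'a tvec" where
  "tscale a v = (\<lambda>f. a * v f)"

definition vscale :: "('a \<Rightarrow> real) \<Rightarrow> 'a vfield \<Rightarrow> 'a vfield" where
  "vscale f X = (\<lambda>p. tscale (f p) (X p))"

(* Derivations at p of the algebra of smooth functions. The value 0 on non-smooth functions
   makes a derivation a unique HOL function, so that equality of tangent vectors is (=). *)
definition tangent_space :: "('a::topological_space, 'n::finite) chart set \<Rightarrow> 'a \<Rightarrow> 'a tvec set" where
  "tangent_space \<A> p = {v.
     (\<forall>f. \<not> smooth_fun \<A> f \<longrightarrow> v f = 0) \<and>
     (\<forall>f h a b. smooth_fun \<A> f \<longrightarrow> smooth_fun \<A> h \<longrightarrow>
        v (\<lambda>q. a * f q + b * h q) = a * v f + b * v h) \<and>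
     (\<forall>f h. smooth_fun \<A> f \<longrightarrow> smooth_fun \<A> h \<longrightarrow>
        v (\<lambda>q. f q * h q) = v f * h p + f p * v h)}"

definition apply_vf :: "'a vfield \<Rightarrow> ('a \<Rightarrow> real) \<Rightarrow> 'a \<Rightarrow> real" where
  "apply_vf X f = (\<lambda>p. X p f)"

definition vector_field :: "('a::topological_space, 'n::finite) chart set \<Rightarrow> 'a vfield \<Rightarrow> bool" where
  "vector_field \<A> X \<longleftrightarrow>
     (\<forall>p. X p \<in> tangent_space \<A> p) \<and> (\<forall>f. smooth_fun \<A> f \<longrightarrow> smooth_fun \<A> (apply_vf X f))"

(* On a non-smooth f both terms vanish for vector fields X, Y, since Y q f = 0 for all q. *)
definition lie_bracket :: "'a vfield \<Rightarrow> 'a vfield \<Rightarrow> 'a vfield" where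
  "lie_bracket X Y = (\<lambda>p f. X p (apply_vf Y f) - Y p (apply_vf X f))"

section \<open>Tensor fields\<close>

type_synonym 'a endo_field = "'a \<Rightarrow> 'a tvec \<Rightarrow> 'a tvec"
type_synonym 'a form_field = "'a \<Rightarrow> 'a tvec \<Rightarrow> 'a tvec \<Rightarrow> real"
type_synonym 'a tensor3 = "'a vfield \<Rightarrow> 'a vfield \<Rightarrow> 'a vfield \<Rightarrow> 'a \<Rightarrow> real"

definition app_endo :: "'a endo_field \<Rightarrow> 'a vfield \<Rightarrow> 'a vfield" where
  "app_endo P X = (\<lambda>p. P p (X p))"

definition app_form :: "'a form_field \<Rightarrow> 'a vfield \<Rightarrow> 'a vfield \<Rightarrow> 'a \<Rightarrow> real" where
  "app_form g X Y = (\<lambda>p. g p (X p) (Y p))"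

definition tensor_11 :: "('a::topological_space, 'n::finite) chart set \<Rightarrow> 'a endo_field \<Rightarrow> bool" where
  "tensor_11 \<A> P \<longleftrightarrow>
     (\<forall>p. \<forall>v\<in>tangent_space \<A> p. P p v \<in> tangent_space \<A> p) \<and>
     (\<forall>p. \<forall>v\<in>tangent_space \<A> p. \<forall>w\<in>tangent_space \<A> p. P p (v + w) = P p v + P p w) \<and>
     (\<forall>p. \<forall>v\<in>tangent_space \<A> p. \<forall>a. P p (tscale a v) = tscale a (P p v)) \<and>
     (\<forall>X. vector_field \<A> X \<longrightarrow> vector_field \<A> (app_endo P X))"

definition riemannian_metric :: "('a::topological_space, 'n::finite) chart set \<Rightarrow> 'a form_field \<Rightarrow> bool" where
  "riemannian_metric \<A> g \<longleftrightarrow>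
     (\<forall>p. \<forall>u\<in>tangent_space \<A> p. \<forall>v\<in>tangent_space \<A> p. \<forall>w\<in>tangent_space \<A> p.
        g p (u + v) w = g p u w + g p v w) \<and>
     (\<forall>p. \<forall>v\<in>tangent_space \<A> p. \<forall>w\<in>tangent_space \<A> p. \<forall>a. g p (tscale a v) w = a * g p v w) \<and>
     (\<forall>p. \<forall>v\<in>tangent_space \<A> p. \<forall>w\<in>tangent_space \<A> p. g p v w = g p w v) \<and>
     (\<forall>p. \<forall>v\<in>tangent_space \<A> p. v \<noteq> 0 \<longrightarrow> g p v v > 0) \<and>
     (\<forall>X Y. vector_field \<A> X \<longrightarrow> vector_field \<A> Y \<longrightarrow> smooth_fun \<A> (app_form g X Y))"

definition lin_comb :: "real ^ 'n \<Rightarrow> ('n::finite \<Rightarrow> 'a tvec) \<Rightarrow> 'a tvec" where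
  "lin_comb c e = (\<Sum>i\<in>UNIV. tscale (c $ i) (e i))"

definition tangent_basis ::
    "('a::topological_space, 'n::finite) chart set \<Rightarrow> 'a \<Rightarrow> ('n \<Rightarrow> 'a tvec) \<Rightarrow> bool" where
  "tangent_basis \<A> p e \<longleftrightarrow>
     (\<forall>i. e i \<in> tangent_space \<A> p) \<and> (\<forall>v\<in>tangent_space \<A> p. \<exists>!c. v = lin_comb c e)"

definition endo_matrix :: "('n::finite \<Rightarrow> 'a tvec) \<Rightarrow> ('a tvec \<Rightarrow> 'a tvec) \<Rightarrow> real ^ 'n ^ 'n" where
  "endo_matrix e L = (\<chi> i j. (THE c. L (e j) = lin_comb c e) $ i)"

definition tr_endo :: "('a::topological_space, 'n::finite) chart set \<Rightarrow> 'a endo_field \<Rightarrow> 'a \<Rightarrow> real" where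
  "tr_endo \<A> P p = trace (endo_matrix (SOME e. tangent_basis \<A> p e) (P p))"

definition is_zero_tensor3 :: "('a::topological_space, 'n::finite) chart set \<Rightarrow> 'a tensor3 \<Rightarrow> bool" where
  "is_zero_tensor3 \<A> S \<longleftrightarrow>
     (\<forall>x y z. vector_field \<A> x \<longrightarrow> vector_field \<A> y \<longrightarrow> vector_field \<A> z \<longrightarrow> (\<forall>p. S x y z p = 0))"

section \<open>Connections\<close>

type_synonym 'a connection = "'a vfield \<Rightarrow> 'a vfield \<Rightarrow> 'a vfield"

definition linear_connection ::
    "('a::topological_space, 'n::finite) chart set \<Rightarrow> 'a connection \<Rightarrow> bool" where
  "linear_connection \<A> D \<longleftrightarrow>
     (\<forall>X Y. vector_field \<A> X \<longrightarrow> vector_field \<A> Y \<longrightarrow> vector_field \<A> (D X Y)) \<and>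
     (\<forall>X Y Z. vector_field \<A> X \<longrightarrow> vector_field \<A> Y \<longrightarrow> vector_field \<A> Z \<longrightarrow>
        D (X + Y) Z = D X Z + D Y Z \<and> D X (Y + Z) = D X Y + D X Z) \<and>
     (\<forall>f X Y. smooth_fun \<A> f \<longrightarrow> vector_field \<A> X \<longrightarrow> vector_field \<A> Y \<longrightarrow>
        D (vscale f X) Y = vscale f (D X Y) \<and>
        D X (vscale f Y) = vscale (apply_vf X f) Y + vscale f (D X Y))"

(* (D_X P) Y *)
definition cov_endo :: "'a connection \<Rightarrow> 'a endo_field \<Rightarrow> 'a vfield \<Rightarrow> 'a vfield \<Rightarrow> 'a vfield" where
  "cov_endo D P X Y = D X (app_endo P Y) - app_endo P (D X Y)"

(* (D_X g) (Y, Z) *)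
definition cov_form :: "'a connection \<Rightarrow> 'a form_field \<Rightarrow> 'a tensor3" where
  "cov_form D g X Y Z = apply_vf X (app_form g Y Z) - app_form g (D X Y) Z - app_form g Y (D X Z)"

definition parallel_endo ::
    "('a::topological_space, 'n::finite) chart set \<Rightarrow> 'a connection \<Rightarrow> 'a endo_field \<Rightarrow> bool" where
  "parallel_endo \<A> D P \<longleftrightarrow>
     (\<forall>X Y. vector_field \<A> X \<longrightarrow> vector_field \<A> Y \<longrightarrow> cov_endo D P X Y = 0)"

definition parallel_form ::
    "('a::topological_space, 'n::finite) chart set \<Rightarrow> 'a connection \<Rightarrow> 'a form_field \<Rightarrow> bool" where
  "parallel_form \<A> D g \<longleftrightarrow> is_zero_tensor3 \<A> (cov_form D g)"

definition torsion :: "'a connection \<Rightarrow> 'a vfield \<Rightarrow> 'a vfield \<Rightarrow> 'a vfield" where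
  "torsion D X Y = D X Y - D Y X - lie_bracket X Y"

definition levi_civita ::
    "('a::topological_space, 'n::finite) chart set \<Rightarrow> 'a form_field \<Rightarrow> 'a connection \<Rightarrow> bool" where
  "levi_civita \<A> g D \<longleftrightarrow>
     linear_connection \<A> D \<and> parallel_form \<A> D g \<and>
     (\<forall>X Y. vector_field \<A> X \<longrightarrow> vector_field \<A> Y \<longrightarrow> torsion D X Y = 0)"

section \<open>Riemannian almost product manifolds\<close>

definition riemannian_almost_product_manifold ::
    "('a::{t2_space, second_countable_topology}, 'n::finite) chart set \<Rightarrow>
     'a endo_field \<Rightarrow> 'a form_field \<Rightarrow> bool" where
  "riemannian_almost_product_manifold \<A> P g \<longleftrightarrow>
     smooth_manifold \<A> \<and> tensor_11 \<A> P \<and> riemannian_metric \<A> g \<and>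
     (\<forall>x. vector_field \<A> x \<longrightarrow> app_endo P (app_endo P x) = x) \<and>
     (\<forall>x y. vector_field \<A> x \<longrightarrow> vector_field \<A> y \<longrightarrow>
        app_form g (app_endo P x) (app_endo P y) = app_form g x y) \<and>
     (\<forall>p. tr_endo \<A> P p = 0)"

(* In the next three definitions D stands for the Levi-Civita connection of g. *)
definition F_tensor :: "'a endo_field \<Rightarrow> 'a form_field \<Rightarrow> 'a connection \<Rightarrow> 'a tensor3" where
  "F_tensor P g D x y z = app_form g (cov_endo D P x y) z"

definition class_W0 ::
    "('a::topological_space, 'n::finite) chart set \<Rightarrow>
     'a endo_field \<Rightarrow> 'a form_field \<Rightarrow> 'a connection \<Rightarrow> bool" where
  "class_W0 \<A> P g D \<longleftrightarrow> is_zero_tensor3 \<A> (F_tensor P g D)"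

definition class_W3 ::
    "('a::topological_space, 'n::finite) chart set \<Rightarrow>
     'a endo_field \<Rightarrow> 'a form_field \<Rightarrow> 'a connection \<Rightarrow> bool" where
  "class_W3 \<A> P g D \<longleftrightarrow>
     (let F = F_tensor P g D in
      is_zero_tensor3 \<A> (\<lambda>x y z p. F x y z p + F y z x p + F z x y p))"

definition natural_connection ::
    "('a::topological_space, 'n::finite) chart set \<Rightarrow>
     'a endo_field \<Rightarrow> 'a form_field \<Rightarrow> 'a connection \<Rightarrow> bool" where
  "natural_connection \<A> P g D \<longleftrightarrow>
     linear_connection \<A> D \<and> parallel_endo \<A> D P \<and> parallel_form \<A> D g"

definition torsion3 :: "'a form_field \<Rightarrow> 'a connection \<Rightarrow> 'a tensor3" where
  "torsion3 g D x y z = app_form g (torsion D x y) z"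

definition p1 :: "'a endo_field \<Rightarrow> 'a tensor3 \<Rightarrow> 'a tensor3" where
  "p1 Pf T x y z q = (let P = app_endo Pf in
     1/8 * (2 * T x y z q - T y z x q - T z x y q - T (P z) x (P y) q + T (P y) z (P x) q
          + T z (P x) (P y) q - 2 * T (P x) (P y) z q + T (P y) (P z) x q + T (P z) (P x) y q
          - T y (P z) (P x) q))"

definition p3 :: "'a endo_field \<Rightarrow> 'a tensor3 \<Rightarrow> 'a tensor3" where
  "p3 Pf T x y z q = (let P = app_endo Pf in
     1/4 * (T x y z q + T (P x) (P y) z q - T (P x) y (P z) q - T x (P y) (P z) q))"

end

theory Submission
  imports Defs
begin

text \<open>
  The idea is that \<open>p\<^sub>1\<close> and \<open>p\<^sub>3\<close> see nothing of a natural connection \<open>D'\<close> beyond the tensor \<open>F\<close>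
  of the Levi-Civita connection \<open>D\<close>. Let \<open>Q(x, y, z) = g(D'\<^sub>x y - D\<^sub>x y, z)\<close>. Since both connections
  are metric, \<open>Q\<close> is skew in its last two arguments; since \<open>D\<close> is torsion-free,
  \<open>T(x, y, z) = Q(x, y, z) - Q(y, x, z)\<close>; and since \<open>D'P = 0\<close>,
  \<open>F(x, y, z) = Q(x, y, Pz) - Q(x, Py, z)\<close>. Inserting the second identity into the definitions of
  \<open>p\<^sub>1\<close> and \<open>p\<^sub>3\<close>, the terms regroup by their first argument into values of \<open>F\<close>
  (lemmas \<open>p1_eq_F\<close> and \<open>p3_eq_F\<close>). The skewness of \<open>Q\<close> gives
  \<open>F(x, y, z) = F(x, z, y) = -F(x, Py, Pz)\<close>.

  If \<open>F\<close> has vanishing cyclic sum, these expressions collapse to \<open>p\<^sub>1 = 0\<close> and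
  \<open>2p\<^sub>3(x, y, z) = -F(x, Py, z) - F(Px, y, z)\<close>. Hence \<open>p\<^sub>3 = 0\<close> would let \<open>P\<close> move from the first to the
  second argument of \<open>F\<close> at the cost of a sign. Write \<open>A(x, y, z) = F(x, Py, z)\<close>, which is skew in
  \<open>y, z\<close>. The cyclic identity at \<open>(Px, y, z)\<close> becomes \<open>A(y, x, z) + A(z, x, y) = A(x, y, z)\<close>, and adding
  the same relation at \<open>(y, z, x)\<close> leaves \<open>2A(y, x, z) = 0\<close>. As \<open>P\<close> is invertible, \<open>F = 0\<close>,
  which is excluded outside \<open>\<W>\<^sub>0\<close>.

  All of this uses finitely many values at one point, obtained by permuting three vector fields
  and applying \<open>P\<close> to them.
\<close>

section \<open>Pointwise algebra of the metric\<close>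

text \<open>
  Differences stay derivations; this is what lets the additivity of a metric, which holds on tangent
  spaces only, be applied to differences of connections.
\<close>

lemma tangent_space_diff:
  assumes "u \<in> tangent_space \<A> p" "v \<in> tangent_space \<A> p"
  shows "u - v \<in> tangent_space \<A> p"
proof -
  have nonsmooth: "w f = 0" if "w \<in> tangent_space \<A> p" "\<not> smooth_fun \<A> f" for w f
    using that unfolding tangent_space_def by blast
  have linear: "w (\<lambda>q. a * f q + b * h q) = a * w f + b * w h"
    if "w \<in> tangent_space \<A> p" "smooth_fun \<A> f" "smooth_fun \<A> h" for w f h a b
    using that unfolding tangent_space_def by blast
  have Leibniz: "w (\<lambda>q. f q * h q) = w f * h p + f p * w h"
    if "w \<in> tangent_space \<A> p" "smooth_fun \<A> f" "smooth_fun \<A> h" for w f h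
    using that unfolding tangent_space_def by blast
  show ?thesis
    unfolding tangent_space_def mem_Collect_eq minus_apply
  proof (intro conjI allI impI)
    fix f assume "\<not> smooth_fun \<A> f"
    then show "u f - v f = 0"
      by (simp add: nonsmooth[OF assms(1)] nonsmooth[OF assms(2)])
  next
    fix f h a b assume "smooth_fun \<A> f" "smooth_fun \<A> h"
    then show "u (\<lambda>q. a * f q + b * h q) - v (\<lambda>q. a * f q + b * h q)
        = a * (u f - v f) + b * (u h - v h)"
      using linear[OF assms(1), of f h a b] linear[OF assms(2), of f h a b]
      by (simp add: right_diff_distrib)
  next
    fix f h assume "smooth_fun \<A> f" "smooth_fun \<A> h"
    then show "u (\<lambda>q. f q * h q) - v (\<lambda>q. f q * h q) = (u f - v f) * h p + f p * (u h - v h)"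
      using Leibniz[OF assms(1), of f h] Leibniz[OF assms(2), of f h]
      by (simp add: right_diff_distrib left_diff_distrib)
  qed
qed

lemma app_form_diff_left:
  assumes g: "riemannian_metric \<A> g"
    and X: "X q \<in> tangent_space \<A> q" and Y: "Y q \<in> tangent_space \<A> q"
    and Z: "Z q \<in> tangent_space \<A> q"
  shows "app_form g (X - Y) Z q = app_form g X Z q - app_form g Y Z q"
proof -
  have additive: "\<forall>p. \<forall>u\<in>tangent_space \<A> p. \<forall>v\<in>tangent_space \<A> p. \<forall>w\<in>tangent_space \<A> p.
      g p (u + v) w = g p u w + g p v w"
    using g unfolding riemannian_metric_def by (rule conjunct1)
  have "g q ((X q - Y q) + Y q) (Z q) = g q (X q - Y q) (Z q) + g q (Y q) (Z q)"
    by (rule additive[rule_format, OF tangent_space_diff[OF X Y] Y Z])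
  then show ?thesis by (simp add: app_form_def)
qed

lemma app_form_sym:
  assumes g: "riemannian_metric \<A> g" and "vector_field \<A> X" "vector_field \<A> Y"
  shows "app_form g X Y q = app_form g Y X q"
proof -
  have "\<forall>p. \<forall>v\<in>tangent_space \<A> p. \<forall>w\<in>tangent_space \<A> p. g p v w = g p w v"
    using g unfolding riemannian_metric_def by (elim conjE)
  then show ?thesis
    using assms(2,3) by (simp add: vector_field_def app_form_def)
qed

section \<open>The difference of a natural connection and the Levi-Civita connection\<close>

locale natural_connection_on_almost_product_manifold =
  fixes \<A> :: "('a::{t2_space, second_countable_topology}, 'n::finite) chart set"
    and P :: "'a endo_field"
    and g :: "'a form_field"
    and D D' :: "'a connection"
  assumes manifold: "riemannian_almost_product_manifold \<A> P g"
    and lc: "levi_civita \<A> g D"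
    and nat: "natural_connection \<A> P g D'"
begin

abbreviation V :: "'a vfield \<Rightarrow> bool" where "V \<equiv> vector_field \<A>"
abbreviation J :: "'a vfield \<Rightarrow> 'a vfield" where "J \<equiv> app_endo P"
abbreviation F :: "'a tensor3" where "F \<equiv> F_tensor P g D"
abbreviation T :: "'a tensor3" where "T \<equiv> torsion3 g D'"

definition Q :: "'a tensor3" where
  "Q x y z q = app_form g (D' x y) z q - app_form g (D x y) z q"

lemma metric: "riemannian_metric \<A> g"
  using manifold by (simp add: riemannian_almost_product_manifold_def)

lemma V_J [simp]: "V x \<Longrightarrow> V (J x)"
  using manifold by (auto simp: riemannian_almost_product_manifold_def tensor_11_def)

lemma J_J [simp]: "V x \<Longrightarrow> J (J x) = x"
  using manifold by (auto simp: riemannian_almost_product_manifold_def)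

lemma V_D [simp]: "V x \<Longrightarrow> V y \<Longrightarrow> V (D x y)"
  using lc by (auto simp: levi_civita_def linear_connection_def)

lemma V_D' [simp]: "V x \<Longrightarrow> V y \<Longrightarrow> V (D' x y)"
  using nat by (auto simp: natural_connection_def linear_connection_def)

lemma V_tangent: "V x \<Longrightarrow> x p \<in> tangent_space \<A> p"
  by (simp add: vector_field_def)

text \<open>An isometric involution is self-adjoint.\<close>

lemma J_self_adjoint:
  assumes "V x" "V y"
  shows "app_form g (J x) y q = app_form g x (J y) q"
proof -
  have "app_form g (J x) (J (J y)) = app_form g x (J y)"
    using manifold assms V_J[of y] unfolding riemannian_almost_product_manifold_def by blast
  with assms show ?thesis by simp
qed

lemma Q_skew:
  assumes "V x" "V y" "V z"
  shows "Q x y z q = - Q x z y q"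
proof -
  have "cov_form D g x y z q = 0" "cov_form D' g x y z q = 0"
    using lc nat assms
    by (auto simp: levi_civita_def natural_connection_def parallel_form_def is_zero_tensor3_def)
  then show ?thesis
    using assms app_form_sym[OF metric, of y "D x z" q] app_form_sym[OF metric, of y "D' x z" q]
    by (simp add: Q_def cov_form_def)
qed

lemma T_eq_Q:
  assumes "V x" "V y" "V z"
  shows "T x y z q = Q x y z q - Q y x z q"
proof -
  \<comment> \<open>Vanishing torsion of \<open>D\<close> expresses the Lie bracket through \<open>D\<close>.\<close>
  have "torsion D x y = 0"
    using lc assms by (auto simp: levi_civita_def)
  then have "torsion D' x y = (D' x y - D' y x) - (D x y - D y x)"
    by (simp add: torsion_def)
  then show ?thesis
    using assms
    by (simp add: torsion3_def Q_def app_form_diff_left[OF metric] V_tangent tangent_space_diff)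
qed

text \<open>
  The endomorphism \<open>D\<^sub>x P\<close> is the commutator of \<open>P\<close> with the difference \<open>D'\<^sub>x - D\<^sub>x\<close>, because \<open>P\<close> commutes
  with \<open>D'\<^sub>x\<close>.
\<close>

lemma F_eq_Q:
  assumes "V x" "V y" "V z"
  shows "F x y z q = Q x y (J z) q - Q x (J y) z q"
proof -
  have "cov_endo D' P x y = 0"
    using nat assms by (auto simp: natural_connection_def parallel_endo_def)
  then have D': "D' x (J y) = J (D' x y)"
    by (simp add: cov_endo_def)
  have "F x y z q = app_form g (D x (J y)) z q - app_form g (D x y) (J z) q"
    using assms
    by (simp add: F_tensor_def cov_endo_def app_form_diff_left[OF metric] V_tangent J_self_adjoint)
  then show ?thesis
    using assms by (simp add: Q_def D' J_self_adjoint)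
qed

lemma F_sym:
  assumes "V x" "V y" "V z"
  shows "F x y z q = F x z y q"
  using assms Q_skew[of x y "J z" q] Q_skew[of x "J y" z q] by (simp add: F_eq_Q)

lemma F_J_skew:
  assumes "V x" "V y" "V z"
  shows "F x (J y) z q = - F x (J z) y q"
  using assms Q_skew[of x "J y" "J z" q] Q_skew[of x y z q] by (simp add: F_eq_Q)

section \<open>The torsion components in terms of F\<close>

text \<open>
  By \<open>T_eq_Q\<close> the four torsion terms become eight values of \<open>Q\<close>; each of \<open>x, Px, y, Py\<close> is the first
  argument of two of them, which together make up one value of \<open>F\<close>.
\<close>

lemma p3_eq_F:
  assumes "V x" "V y" "V z"
  shows "4 * p3 P T x y z q = F y (J x) z q + F (J y) x z q - F x (J y) z q - F (J x) y z q"
  using assms by (simp add: p3_def Let_def T_eq_Q F_eq_Q)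

text \<open>
  As for \<open>p\<^sub>3\<close>, but the regrouping now needs the skewness of \<open>Q\<close> to bring the terms with a common
  first argument to the same order; the terms headed by \<open>Pz\<close> cancel.
\<close>

lemma p1_eq_F:
  assumes "V x" "V y" "V z"
  shows "8 * p1 P T x y z q =
    F y (J x) z q - F (J y) x z q - F x (J y) z q + F (J x) y z q + 2 * F z (J x) y q"
  using assms
    Q_skew[of x z y q] Q_skew[of x "J z" "J y" q]
    Q_skew[of y z x q] Q_skew[of y "J z" "J x" q]
    Q_skew[of z y x q] Q_skew[of z "J y" "J x" q]
    Q_skew[of "J x" z "J y" q] Q_skew[of "J x" "J z" y q]
    Q_skew[of "J y" z "J x" q] Q_skew[of "J y" "J z" x q]
    Q_skew[of "J z" "J y" x q] Q_skew[of "J z" y "J x" q]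
  by (simp add: p1_def Let_def T_eq_Q F_eq_Q)

end

section \<open>The class W3\<close>

locale natural_connection_on_W3_manifold = natural_connection_on_almost_product_manifold +
  assumes W3: "class_W3 \<A> P g D"
begin

lemma F_cyclic:
  assumes "V x" "V y" "V z"
  shows "F x y z q + F y z x q + F z x y q = 0"
  using W3 assms by (auto simp: class_W3_def Let_def is_zero_tensor3_def)

lemma F_cyclic_J:
  assumes "V x" "V y" "V z"
  shows "F (J x) y z q + F y (J x) z q + F z (J x) y q = 0"
  using assms F_cyclic[of "J x" y z q] F_sym[of y z "J x" q] by simp

text \<open>
  \<open>F_cyclic_J\<close> at \<open>(x, y, z)\<close> and at \<open>(y, x, z)\<close> eliminates all values of \<open>F\<close> headed by \<open>x, Px, y, Py\<close>
  in favour of \<open>F(z, Px, y)\<close> and \<open>F(z, Py, x)\<close>, which are opposite to each other.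
\<close>

lemma p1_vanishes:
  assumes "V x" "V y" "V z"
  shows "p1 P T x y z q = 0"
  using assms p1_eq_F[of x y z q] F_cyclic_J[of x y z q] F_cyclic_J[of y x z q] F_J_skew[of z x y q]
  by simp

lemma p3_eq_F_W3:
  assumes "V x" "V y" "V z"
  shows "2 * p3 P T x y z q = - F x (J y) z q - F (J x) y z q"
  using assms p3_eq_F[of x y z q] F_cyclic_J[of x y z q] F_cyclic_J[of y x z q] F_J_skew[of z x y q]
  by simp

lemma F_vanishes_if_p3_vanishes:
  assumes p3: "is_zero_tensor3 \<A> (p3 P T)"
  shows "is_zero_tensor3 \<A> F"
proof -
  have move: "F (J x) y z q = - F x (J y) z q" if "V x" "V y" "V z" for x y z q
    using p3_eq_F_W3[OF that, of q] p3 that by (simp add: is_zero_tensor3_def)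
  \<comment> \<open>Below \<open>A\<close> stands for \<open>(x, y, z) \<mapsto> F(x, Py, z)\<close>, which is skew in \<open>y\<close> and \<open>z\<close>.\<close>
  have A_rel: "F y (J x) z q + F z (J x) y q = F x (J y) z q" if "V x" "V y" "V z" for x y z q
    using F_cyclic_J[OF that, of q] move[OF that, of q] by simp
  have A_zero: "F y (J x) z q = 0" if "V x" "V y" "V z" for x y z q
    using that A_rel[of x y z q] A_rel[of y z x q] F_J_skew[of x y z q]
      F_J_skew[of y z x q] F_J_skew[of z x y q] by simp
  have "F x y z q = 0" if "V x" "V y" "V z" for x y z q
    using A_zero[of "J y" x z q] that by simp
  then show ?thesis by (simp add: is_zero_tensor3_def)
qed

end

theorem proposition3p3:
  fixes \<A> :: "('a::{t2_space, second_countable_topology}, 'n::finite) chart set"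
    and P :: "'a endo_field"
    and g :: "'a form_field"
    and D D' :: "'a connection"
  assumes "riemannian_almost_product_manifold \<A> P g"
    and "levi_civita \<A> g D"
    and "class_W3 \<A> P g D"
    and "\<not> class_W0 \<A> P g D"
    and "natural_connection \<A> P g D'"
  shows "is_zero_tensor3 \<A> (p1 P (torsion3 g D')) \<and>
         \<not> is_zero_tensor3 \<A> (p3 P (torsion3 g D'))"
proof -
  interpret natural_connection_on_W3_manifold \<A> P g D D'
    using assms by unfold_locales
  show ?thesis
    using p1_vanishes F_vanishes_if_p3_vanishes assms(4)
    by (auto simp: is_zero_tensor3_def class_W0_def)
qed

end
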